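(* Let $n\ge1$ and let $X_1,\dots,X_n$ be real-valued random variables on a common probability space satisfying $\mathbb{E}[\exp(X_i^2/\sigma_i^2)]\le\rho_i$ for $i=1,\dots,n$, with constants $\sigma_i>0$ and $\rho_i\ge1$. Then: (i) Every real-valued random variable $X$ with $|X|\le\sum_{i=1}^n|X_i|$ satisfies $\mathbb{E}[\exp(X^2/\sigma^2)]\le\rho$ with $$\sigma=\sum_{i=1}^n\sigma_i,\qquad \ln\rho=\frac{\sum_{i=1}^n\sigma_i\ln\rho_i}{\sum_{i=1}^n\sigma_i}.$$ (ii) Every real-valued random variable $X$ with $|X|\le\sqrt{\sum_{i=1}^nX_i^2}$ satisfies $\mathbb{E}[\exp(X^2/\sigma^2)]\le\rho$ with $$\sigma=\sqrt{\sum_{i=1}^n\sigma_i^2},\qquad \ln\rho=\frac{\sum_{i=1}^n\sigma_i^2\ln\rho_i}{\sum_{i=1}^n\sigma_i^2}.$$ (iii) If $X_1,\dots,X_n$ are independent, then $X:=\sum_{i=1}^nX_i$ satisfies $\mathbb{E}[\exp(X^2/\sigma^2)]\le\rho$ with $$\sigma=\sqrt{\sum_{i=1}^n\sigma_i^2},\qquad \rho=\prod_{i=1}^n\rho_i.$$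
   Context: Expectations of nonnegative random variables are taken in $[0,+\infty]$, so an upper bound by a finite number includes the assertion that the expectation is finite. *)

theory Defs imports "HOL-Probability.Probability" begin

end

theory Submission imports Defs begin

text \<open>
  Each part bounds the square of the normalised variable pointwise by a combination of the exponents
  \<open>X\<^sub>i\<^sup>2 / \<sigma>\<^sub>i\<^sup>2\<close> and then integrates the exponential of that combination.

  In the first two parts the combination is convex, with weights \<open>\<sigma>\<^sub>i / \<Sum>\<sigma>\<^sub>j\<close> and
  \<open>\<sigma>\<^sub>i\<^sup>2 / \<Sum>\<sigma>\<^sub>j\<^sup>2\<close>, respectively.  Such weights turn the separate bounds on the exponential
  moments into their weighted geometric mean, by Hoelder's inequality
  (\<open>nn_integral_exp_convex_comb_le\<close>).  In the third part the combination is the plain sum of the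
  exponents, and the exponential of a sum of independent variables factorises under the expectation
  (\<open>nn_integral_exp_sum_indep_le\<close>).  Mixed products \<open>X\<^sub>i X\<^sub>j\<close> never appear in an expectation, as the
  pointwise bound has already absorbed them.

  For the first and third part the pointwise bound is one form of the Cauchy--Schwarz inequality,
  \<open>sum_power2_divide_le\<close>, with denominators \<open>\<sigma>\<^sub>i\<close> and \<open>\<sigma>\<^sub>i\<^sup>2\<close>; for the second part it is immediate
  from squaring the hypothesis.
\<close>

text \<open>
  Cauchy--Schwarz applied to \<open>y\<^sub>i / sqrt a\<^sub>i\<close> and \<open>sqrt a\<^sub>i\<close>.  Having the total of the \<open>a\<^sub>i\<close> as a
  denominator makes the inequality usable both with \<open>a = \<sigma>\<close> and with \<open>a = \<sigma>\<^sup>2\<close>.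
\<close>

lemma sum_power2_divide_le:
  fixes y a :: "'i \<Rightarrow> real"
  assumes a: "\<And>i. i \<in> I \<Longrightarrow> a i > 0"
  shows "(\<Sum>i\<in>I. y i)\<^sup>2 / (\<Sum>i\<in>I. a i) \<le> (\<Sum>i\<in>I. (y i)\<^sup>2 / a i)"
proof -
  have nonneg: "(\<Sum>i\<in>I. a i) \<ge> 0" "(\<Sum>i\<in>I. (y i)\<^sup>2 / a i) \<ge> 0"
    using a by (auto intro!: sum_nonneg simp: less_imp_le)
  have "(\<Sum>i\<in>I. y i)\<^sup>2 = (\<Sum>i\<in>I. (y i / sqrt (a i)) * sqrt (a i))\<^sup>2"
    using a by (intro arg_cong[where f = "\<lambda>x. x\<^sup>2"] sum.cong) (auto dest: less_imp_neq[symmetric])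
  also have "\<dots> \<le> (\<Sum>i\<in>I. (y i / sqrt (a i))\<^sup>2) * (\<Sum>i\<in>I. (sqrt (a i))\<^sup>2)"
    by (rule Cauchy_Schwarz_ineq_sum)
  also have "\<dots> = (\<Sum>i\<in>I. (y i)\<^sup>2 / a i) * (\<Sum>i\<in>I. a i)"
    using a by (simp add: power_divide less_imp_le)
  finally show ?thesis
    using nonneg by (cases "(\<Sum>i\<in>I. a i) = 0") (simp_all add: divide_le_eq)
qed

text \<open>
  The weighted Hoelder inequality in exponential form.  After dividing each \<open>exp (Z i)\<close> by its bound
  \<open>\<rho> i\<close>, it is enough to treat the case of all bounds equal to \<open>1\<close>, where convexity of \<open>exp\<close> bounds
  the exponential of the convex combination by the convex combination of the exponentials, whose
  integral is at most \<open>1\<close>.  \<close>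

lemma nn_integral_exp_convex_comb_le:
  fixes Z :: "'i \<Rightarrow> 'a \<Rightarrow> real" and w \<rho> :: "'i \<Rightarrow> real"
  assumes I: "finite I"
    and meas: "\<And>i. i \<in> I \<Longrightarrow> Z i \<in> borel_measurable M"
    and w: "\<And>i. i \<in> I \<Longrightarrow> w i \<ge> 0" "(\<Sum>i\<in>I. w i) = 1"
    and \<rho>: "\<And>i. i \<in> I \<Longrightarrow> \<rho> i > 0"
    and bound: "\<And>i. i \<in> I \<Longrightarrow> (\<integral>\<^sup>+x. ennreal (exp (Z i x)) \<partial>M) \<le> ennreal (\<rho> i)"
    and Y: "AE x in M. Y x \<le> (\<Sum>i\<in>I. w i * Z i x)"
  shows "(\<integral>\<^sup>+x. ennreal (exp (Y x)) \<partial>M) \<le> ennreal (exp (\<Sum>i\<in>I. w i * ln (\<rho> i)))"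
proof -
  define L where "L = (\<Sum>i\<in>I. w i * ln (\<rho> i))"
  have nonempty: "I \<noteq> {}"
    using w(2) by auto
  have jensen: "exp (\<Sum>i\<in>I. w i * Z i x) \<le> exp L * (\<Sum>i\<in>I. w i / \<rho> i * exp (Z i x))" for x
  proof -
    have "exp (\<Sum>i\<in>I. w i * Z i x) = exp L * exp (\<Sum>i\<in>I. w i *\<^sub>R (Z i x - ln (\<rho> i)))"
      unfolding L_def by (simp add: exp_add[symmetric] right_diff_distrib sum_subtractf)
    also have "exp (\<Sum>i\<in>I. w i *\<^sub>R (Z i x - ln (\<rho> i))) \<le> (\<Sum>i\<in>I. w i * exp (Z i x - ln (\<rho> i)))"
      using I nonempty w by (intro convex_on_sum[OF _ _ exp_convex]) auto
    also have "\<dots> = (\<Sum>i\<in>I. w i / \<rho> i * exp (Z i x))"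
      using \<rho> by (intro sum.cong) (auto simp: exp_diff)
    finally show ?thesis
      by simp
  qed
  have "(\<integral>\<^sup>+x. ennreal (exp (Y x)) \<partial>M)
      \<le> (\<integral>\<^sup>+x. ennreal (exp L) * (\<Sum>i\<in>I. ennreal (w i / \<rho> i) * ennreal (exp (Z i x))) \<partial>M)"
  proof (rule nn_integral_mono_AE, use Y in eventually_elim)
    case (elim x)
    have "ennreal (exp (Y x)) \<le> ennreal (exp L * (\<Sum>i\<in>I. w i / \<rho> i * exp (Z i x)))"
      using elim by (intro ennreal_leI order.trans[OF _ jensen]) simp
    also have "\<dots> = ennreal (exp L) * (\<Sum>i\<in>I. ennreal (w i / \<rho> i * exp (Z i x)))"
      using w(1) \<rho> by (simp add: ennreal_mult'' sum_nonneg less_imp_le sum_ennreal)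
    also have "(\<Sum>i\<in>I. ennreal (w i / \<rho> i * exp (Z i x)))
        = (\<Sum>i\<in>I. ennreal (w i / \<rho> i) * ennreal (exp (Z i x)))"
      by (intro sum.cong refl ennreal_mult'') simp
    finally show ?case .
  qed
  also have "\<dots> = ennreal (exp L) * (\<Sum>i\<in>I. ennreal (w i / \<rho> i) * (\<integral>\<^sup>+x. ennreal (exp (Z i x)) \<partial>M))"
    using meas by (simp add: nn_integral_cmult nn_integral_sum)
  also have "\<dots> \<le> ennreal (exp L) * (\<Sum>i\<in>I. ennreal (w i / \<rho> i) * ennreal (\<rho> i))"
    using bound by (intro mult_left_mono sum_mono) auto
  also have "(\<Sum>i\<in>I. ennreal (w i / \<rho> i) * ennreal (\<rho> i)) = (\<Sum>i\<in>I. ennreal (w i))"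
    using w(1) \<rho> by (intro sum.cong refl, subst ennreal_mult[symmetric])
      (auto simp: less_imp_le dest: less_imp_neq[symmetric])
  also have "\<dots> = 1"
    using w by (simp add: sum_ennreal)
  finally show ?thesis
    by (simp add: L_def)
qed

lemma (in prob_space) nn_integral_exp_sum_indep_le:
  fixes Z :: "'i \<Rightarrow> 'a \<Rightarrow> real" and \<rho> :: "'i \<Rightarrow> real"
  assumes I: "finite I"
    and indep: "indep_vars (\<lambda>_. borel) Z I"
    and \<rho>: "\<And>i. i \<in> I \<Longrightarrow> \<rho> i \<ge> 0"
    and bound: "\<And>i. i \<in> I \<Longrightarrow> (\<integral>\<^sup>+x. ennreal (exp (Z i x)) \<partial>M) \<le> ennreal (\<rho> i)"
  shows "(\<integral>\<^sup>+x. ennreal (exp (\<Sum>i\<in>I. Z i x)) \<partial>M) \<le> ennreal (\<Prod>i\<in>I. \<rho> i)"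
proof -
  have indep_exp: "indep_vars (\<lambda>_. borel) (\<lambda>i x. ennreal (exp (Z i x))) I"
    by (rule indep_vars_compose2[OF indep]) simp
  have "(\<integral>\<^sup>+x. ennreal (exp (\<Sum>i\<in>I. Z i x)) \<partial>M) = (\<integral>\<^sup>+x. (\<Prod>i\<in>I. ennreal (exp (Z i x))) \<partial>M)"
    using I by (simp add: exp_sum prod_ennreal)
  also have "\<dots> = (\<Prod>i\<in>I. \<integral>\<^sup>+x. ennreal (exp (Z i x)) \<partial>M)"
    using I indep_exp by (intro indep_vars_nn_integral) auto
  also have "\<dots> \<le> (\<Prod>i\<in>I. ennreal (\<rho> i))"
    using bound by (intro prod_mono_ennreal)
  also have "\<dots> = ennreal (\<Prod>i\<in>I. \<rho> i)"
    using \<rho> by (simp add: prod_ennreal)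
  finally show ?thesis .
qed

theorem theorem9:
  fixes M :: "'a measure" and n :: nat
    and X :: "nat \<Rightarrow> 'a \<Rightarrow> real" and \<sigma> \<rho> :: "nat \<Rightarrow> real"
  assumes "prob_space M"
    and "n \<ge> 1"
    and "\<And>i. i \<in> {1..n} \<Longrightarrow> X i \<in> borel_measurable M"
    and "\<And>i. i \<in> {1..n} \<Longrightarrow> \<sigma> i > 0"
    and "\<And>i. i \<in> {1..n} \<Longrightarrow> \<rho> i \<ge> 1"
    and "\<And>i. i \<in> {1..n} \<Longrightarrow>
           (\<integral>\<^sup>+\<omega>. ennreal (exp ((X i \<omega>)\<^sup>2 / (\<sigma> i)\<^sup>2)) \<partial>M) \<le> ennreal (\<rho> i)"
  shows
    "(\<forall>Y\<in>borel_measurable M. \<forall>s r :: real.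
        (AE \<omega> in M. \<bar>Y \<omega>\<bar> \<le> (\<Sum>i=1..n. \<bar>X i \<omega>\<bar>)) \<longrightarrow>
        s = (\<Sum>i=1..n. \<sigma> i) \<longrightarrow>
        r > 0 \<longrightarrow> ln r = (\<Sum>i=1..n. \<sigma> i * ln (\<rho> i)) / (\<Sum>i=1..n. \<sigma> i) \<longrightarrow>
        (\<integral>\<^sup>+\<omega>. ennreal (exp ((Y \<omega>)\<^sup>2 / s\<^sup>2)) \<partial>M) \<le> ennreal r) \<and>
     (\<forall>Y\<in>borel_measurable M. \<forall>s r :: real.
        (AE \<omega> in M. \<bar>Y \<omega>\<bar> \<le> sqrt (\<Sum>i=1..n. (X i \<omega>)\<^sup>2)) \<longrightarrow>
        s = sqrt (\<Sum>i=1..n. (\<sigma> i)\<^sup>2) \<longrightarrow>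
        r > 0 \<longrightarrow> ln r = (\<Sum>i=1..n. (\<sigma> i)\<^sup>2 * ln (\<rho> i)) / (\<Sum>i=1..n. (\<sigma> i)\<^sup>2) \<longrightarrow>
        (\<integral>\<^sup>+\<omega>. ennreal (exp ((Y \<omega>)\<^sup>2 / s\<^sup>2)) \<partial>M) \<le> ennreal r) \<and>
     (prob_space.indep_vars M (\<lambda>_. borel) X {1..n} \<longrightarrow>
        (\<forall>s r :: real.
           s = sqrt (\<Sum>i=1..n. (\<sigma> i)\<^sup>2) \<longrightarrow>
           r = (\<Prod>i=1..n. \<rho> i) \<longrightarrow>
           (\<integral>\<^sup>+\<omega>. ennreal (exp ((\<Sum>i=1..n. X i \<omega>)\<^sup>2 / s\<^sup>2)) \<partial>M) \<le> ennreal r))"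
proof (intro conjI ballI allI impI)
  note X_meas = assms(3) and \<sigma>_pos = assms(4) and \<rho>_ge = assms(5) and bound = assms(6)
  note [measurable] = X_meas
  have Z_meas: "(\<lambda>x. (X i x)\<^sup>2 / (\<sigma> i)\<^sup>2) \<in> borel_measurable M" if "i \<in> {1..n}" for i
    using that by measurable
  have \<sigma>2_pos: "(\<sigma> i)\<^sup>2 > 0" if "i \<in> {1..n}" for i
    using \<sigma>_pos[OF that] by simp
  have \<rho>_pos: "\<rho> i > 0" if "i \<in> {1..n}" for i
    using \<rho>_ge[OF that] by simp
  {
    fix Y s r
    assume Y: "AE \<omega> in M. \<bar>Y \<omega>\<bar> \<le> (\<Sum>i=1..n. \<bar>X i \<omega>\<bar>)" and s: "s = (\<Sum>i=1..n. \<sigma> i)"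
      and r: "r > 0" "ln r = (\<Sum>i=1..n. \<sigma> i * ln (\<rho> i)) / (\<Sum>i=1..n. \<sigma> i)"
    have s_pos: "s > 0"
      unfolding s using \<sigma>_pos \<open>n \<ge> 1\<close> by (intro sum_pos) auto
    have "(\<integral>\<^sup>+\<omega>. ennreal (exp ((Y \<omega>)\<^sup>2 / s\<^sup>2)) \<partial>M)
        \<le> ennreal (exp (\<Sum>i=1..n. (\<sigma> i / s) * ln (\<rho> i)))"
    proof (rule nn_integral_exp_convex_comb_le[OF _ Z_meas _ _ \<rho>_pos bound])
      show "(\<Sum>i=1..n. \<sigma> i / s) = 1"
        using s_pos unfolding sum_divide_distrib[symmetric] s[symmetric] by simp
      show "AE \<omega> in M. (Y \<omega>)\<^sup>2 / s\<^sup>2 \<le> (\<Sum>i=1..n. \<sigma> i / s * ((X i \<omega>)\<^sup>2 / (\<sigma> i)\<^sup>2))"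
        using Y
      proof eventually_elim
        case (elim \<omega>)
        have "(Y \<omega>)\<^sup>2 / s\<^sup>2 \<le> (\<Sum>i=1..n. \<bar>X i \<omega>\<bar>)\<^sup>2 / s\<^sup>2"
          using power_mono[OF elim, of 2] by (simp add: divide_right_mono)
        also have "\<dots> = ((\<Sum>i=1..n. \<bar>X i \<omega>\<bar>)\<^sup>2 / (\<Sum>i=1..n. \<sigma> i)) / s"
          by (simp add: s power2_eq_square)
        also have "\<dots> \<le> (\<Sum>i=1..n. \<bar>X i \<omega>\<bar>\<^sup>2 / \<sigma> i) / s"
          using s_pos \<sigma>_pos by (intro divide_right_mono sum_power2_divide_le) auto
        also have "\<dots> = (\<Sum>i=1..n. \<sigma> i / s * ((X i \<omega>)\<^sup>2 / (\<sigma> i)\<^sup>2))"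
          unfolding sum_divide_distrib
          by (intro sum.cong) (auto simp: power2_eq_square divide_simps)
        finally show ?case .
      qed
    qed (use \<sigma>_pos s_pos in \<open>auto simp: less_imp_le\<close>)
    also have "(\<Sum>i=1..n. (\<sigma> i / s) * ln (\<rho> i)) = ln r"
      by (simp add: r(2) s sum_divide_distrib)
    finally show "(\<integral>\<^sup>+\<omega>. ennreal (exp ((Y \<omega>)\<^sup>2 / s\<^sup>2)) \<partial>M) \<le> ennreal r"
      using r(1) by simp
  next
    fix s :: real
    assume "s = sqrt (\<Sum>i=1..n. (\<sigma> i)\<^sup>2)"
    then have s2: "s\<^sup>2 = (\<Sum>i=1..n. (\<sigma> i)\<^sup>2)"
      by (simp add: sum_nonneg)
    have s2_pos: "s\<^sup>2 > 0"
      unfolding s2 using \<sigma>2_pos \<open>n \<ge> 1\<close> by (intro sum_pos) simp_all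
    {
      fix Y r
      assume Y: "AE \<omega> in M. \<bar>Y \<omega>\<bar> \<le> sqrt (\<Sum>i=1..n. (X i \<omega>)\<^sup>2)"
        and r: "r > 0" "ln r = (\<Sum>i=1..n. (\<sigma> i)\<^sup>2 * ln (\<rho> i)) / (\<Sum>i=1..n. (\<sigma> i)\<^sup>2)"
      have "(\<integral>\<^sup>+\<omega>. ennreal (exp ((Y \<omega>)\<^sup>2 / s\<^sup>2)) \<partial>M)
          \<le> ennreal (exp (\<Sum>i=1..n. ((\<sigma> i)\<^sup>2 / s\<^sup>2) * ln (\<rho> i)))"
      proof (rule nn_integral_exp_convex_comb_le[OF _ Z_meas _ _ \<rho>_pos bound])
        show "(\<Sum>i=1..n. (\<sigma> i)\<^sup>2 / s\<^sup>2) = 1"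
          using s2_pos unfolding sum_divide_distrib[symmetric] s2[symmetric] by simp
        show "AE \<omega> in M. (Y \<omega>)\<^sup>2 / s\<^sup>2 \<le> (\<Sum>i=1..n. (\<sigma> i)\<^sup>2 / s\<^sup>2 * ((X i \<omega>)\<^sup>2 / (\<sigma> i)\<^sup>2))"
          using Y
        proof eventually_elim
          case (elim \<omega>)
          have "(Y \<omega>)\<^sup>2 \<le> (\<Sum>i=1..n. (X i \<omega>)\<^sup>2)"
            using power_mono[OF elim, of 2] by (simp add: sum_nonneg)
          then have "(Y \<omega>)\<^sup>2 / s\<^sup>2 \<le> (\<Sum>i=1..n. (X i \<omega>)\<^sup>2) / s\<^sup>2"
            by (simp add: divide_right_mono)
          also have "\<dots> = (\<Sum>i=1..n. (\<sigma> i)\<^sup>2 / s\<^sup>2 * ((X i \<omega>)\<^sup>2 / (\<sigma> i)\<^sup>2))"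
            unfolding sum_divide_distrib
            by (intro sum.cong refl) (use \<sigma>2_pos in force)
          finally show ?case .
        qed
      qed auto
      also have "(\<Sum>i=1..n. ((\<sigma> i)\<^sup>2 / s\<^sup>2) * ln (\<rho> i)) = ln r"
        by (simp add: r(2) s2 sum_divide_distrib)
      finally show "(\<integral>\<^sup>+\<omega>. ennreal (exp ((Y \<omega>)\<^sup>2 / s\<^sup>2)) \<partial>M) \<le> ennreal r"
        using r(1) by simp
    next
      interpret prob_space M by fact
      fix r
      assume indep: "indep_vars (\<lambda>_. borel) X {1..n}" and r: "r = (\<Prod>i=1..n. \<rho> i)"
      have "(\<Sum>i=1..n. X i \<omega>)\<^sup>2 / s\<^sup>2 \<le> (\<Sum>i=1..n. (X i \<omega>)\<^sup>2 / (\<sigma> i)\<^sup>2)" for \<omega>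
        unfolding s2 by (rule sum_power2_divide_le) (use \<sigma>2_pos in simp)
      then have "(\<integral>\<^sup>+\<omega>. ennreal (exp ((\<Sum>i=1..n. X i \<omega>)\<^sup>2 / s\<^sup>2)) \<partial>M)
          \<le> (\<integral>\<^sup>+\<omega>. ennreal (exp (\<Sum>i=1..n. (X i \<omega>)\<^sup>2 / (\<sigma> i)\<^sup>2)) \<partial>M)"
        by (intro nn_integral_mono ennreal_leI) simp
      also have "\<dots> \<le> ennreal (\<Prod>i=1..n. \<rho> i)"
      proof (rule nn_integral_exp_sum_indep_le[OF _ _ _ bound])
        show "indep_vars (\<lambda>_. borel) (\<lambda>i \<omega>. (X i \<omega>)\<^sup>2 / (\<sigma> i)\<^sup>2) {1..n}"
          by (rule indep_vars_compose2[OF indep]) simp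
      qed (use \<rho>_pos in \<open>simp_all add: less_imp_le\<close>)
      finally show "(\<integral>\<^sup>+\<omega>. ennreal (exp ((\<Sum>i=1..n. X i \<omega>)\<^sup>2 / s\<^sup>2)) \<partial>M) \<le> ennreal r"
        by (simp add: r)
    }
  }
qed

end
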